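(* Let $F$ be $\mathbb{R}$ or $\mathbb{C}$, let $n,n'\ge 1$ and $q'\ge 0$ be integers, let $\rho\in[1,\infty]$ and let $\varrho\in[1,\infty]$ satisfy $\frac1\rho+\frac1\varrho=1$. For every integer $m\ge 0$ let $A(m)\in M_{n,n'}(m,q';F)$, and consider the power series in $x=(x_1,\dots,x_n)$ $$\sum_{m=0}^{\infty}\frac{x^{(m)}}{m!}A(m).$$ Put $r=\overline{\lim}_{m\to\infty}\|A(m)\|_{\rho}^{1/m}\in[0,\infty]$ and $R=\frac1r\in[0,\infty]$ (with $1/0=\infty$ and $1/\infty=0$). Then the power series is absolutely convergent at every $h\in F^n$ with $\|h\|_{\varrho}<R$, and for any real $R_1>R\,n^{\frac{\rho-1}{\rho}}$ (where $\frac{\rho-1}{\rho}$ is read as $1$ if $\rho=\infty$) there exists $\overline h\in F^n$ with $\|\overline h\|_{\varrho}=R_1$ such that the power series is not absolutely convergent at $\overline h$.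
   Context: For a positive integer $k$, $I_k$ is the set of $k$-tuples of nonnegative integers (multiindices); for $\alpha\in I_k$, $|\alpha|=\alpha_1+\dots+\alpha_k$, $\alpha!=\alpha_1!\cdots\alpha_k!$, and $h^\alpha=h_1^{\alpha_1}\cdots h_k^{\alpha_k}$. For nonnegative integers $p,p'$, $M_{n,n'}(p,p';F)$ is the set of matrices $A=(A_{\alpha,\alpha'})$ with entries in $F$, whose rows are indexed by $\alpha\in I_n$ with $|\alpha|=p$ and whose columns are indexed by $\alpha'\in I_{n'}$ with $|\alpha'|=p'$. The $\rho$-norm of $A\in M_{n,n'}(p,p';F)$ is $$\|A\|_\rho=\Bigl(\sum_{\alpha,\alpha'}\frac{|A_{\alpha,\alpha'}|^\rho}{\alpha!\,(p!\,p'!)^{\rho-1}}\Bigr)^{1/\rho}\ (1\le\rho<\infty),\qquad \|A\|_\infty=\frac{\sup_{\alpha,\alpha'}|A_{\alpha,\alpha'}|}{p!\,p'!}.$$ A vector $h\in F^n$ is regarded as an element of $M_{n,n}(0,1;F)$, so $\|h\|_\varrho$ is the usual $\ell^\varrho$-norm $(\sum_i|h_i|^\varrho)^{1/\varrho}$ (respectively $\max_i|h_i|$ if $\varrho=\infty$). For $x=(x_1,\dots,x_n)$, $x^{(m)}$ is the row matrix indexed by $\alpha\in I_n$, $|\alpha|=m$, with entries $(x^{(m)})_{0,\alpha}=\frac{m!}{\alpha!}x^\alpha$ (it is the $m$-th power of $x$ for the product $\bigodot$ of the paper). Hence $\frac{x^{(m)}}{m!}A(m)$ (ordinary matrix product)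 is the row with components $\sum_{|\alpha|=m}\frac{x^\alpha}{\alpha!}A(m)_{\alpha,\alpha'}$, $\alpha'\in I_{n'}$, $|\alpha'|=q'$. The power series $\sum_{m}\frac{x^{(m)}}{m!}A(m)$ is called absolutely convergent at $h\in F^n$ if for each $\alpha'\in I_{n'}$ with $|\alpha'|=q'$ the series of nonnegative terms $\sum_{\alpha\in I_n}\bigl|\frac{h^\alpha}{\alpha!}A(|\alpha|)_{\alpha,\alpha'}\bigr|$ converges. *)

theory Defs
  imports "HOL-Analysis.Analysis"
begin

(* I_n is the type 'n mindex with n = CARD('n), so n >= 1 holds automatically. *)
type_synonym 'n mindex = "'n \<Rightarrow> nat"

definition mdeg :: "'n::finite mindex \<Rightarrow> nat" where
  "mdeg \<alpha> = (\<Sum>i\<in>UNIV. \<alpha> i)"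

definition mfact :: "'n::finite mindex \<Rightarrow> nat" where
  "mfact \<alpha> = (\<Prod>i\<in>UNIV. fact (\<alpha> i))"

definition mpower :: "('a::comm_monoid_mult) ^ 'n \<Rightarrow> 'n::finite mindex \<Rightarrow> 'a" where
  "mpower h \<alpha> = (\<Prod>i\<in>UNIV. (h $ i) ^ \<alpha> i)"

definition munit :: "'n::finite \<Rightarrow> 'n mindex" where
  "munit i = (\<lambda>j. if j = i then 1 else 0)"

definition mindices :: "nat \<Rightarrow> 'n::finite mindex set" where
  "mindices p = {\<alpha>. mdeg \<alpha> = p}"

(* M_{n,n'}(p,p';F), with matrices extended by 0 outside their index range. *)
definition mmatrices ::
    "nat \<Rightarrow> nat \<Rightarrow> ('n::finite mindex \<Rightarrow> 'k::finite mindex \<Rightarrow> 'a::zero) set" where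
  "mmatrices p p' = {A. \<forall>\<alpha> \<alpha>'. A \<alpha> \<alpha>' \<noteq> 0 \<longrightarrow> \<alpha> \<in> mindices p \<and> \<alpha>' \<in> mindices p'}"

(* F is a type of class real_normed_field: real and complex are, up to isometric isomorphism, the
   only instances (Gelfand-Mazur), so polymorphic statements cover exactly these two fields. *)
definition rho_norm ::
    "ennreal \<Rightarrow> nat \<Rightarrow> nat \<Rightarrow>
     ('n::finite mindex \<Rightarrow> 'k::finite mindex \<Rightarrow> 'a::real_normed_field) \<Rightarrow> real" where
  "rho_norm \<rho> p p' A =
    (if \<rho> = \<infinity>
     then (SUP (\<alpha>, \<alpha>') \<in> mindices p \<times> mindices p'. norm (A \<alpha> \<alpha>')) / (fact p * fact p')
     else (let s = enn2real \<rho> in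
       (\<Sum>\<alpha>\<in>mindices p. \<Sum>\<alpha>'\<in>mindices p'.
          norm (A \<alpha> \<alpha>') powr s / (real (mfact \<alpha>) * (fact p * fact p') powr (s - 1)))
       powr (1 / s)))"

(* A vector h as an element of M_{n,n}(0,1;F): the entry in row 0 and column e_i is h_i. *)
definition vec_matrix :: "'a::real_normed_field ^ 'n \<Rightarrow> 'n::finite mindex \<Rightarrow> 'n mindex \<Rightarrow> 'a" where
  "vec_matrix h \<alpha> \<alpha>' = (\<Sum>i | \<alpha> = (\<lambda>_. 0) \<and> \<alpha>' = munit i. h $ i)"

definition vec_norm :: "ennreal \<Rightarrow> 'a::real_normed_field ^ 'n::finite \<Rightarrow> real" where
  "vec_norm \<rho> h = rho_norm \<rho> 0 1 (vec_matrix h)"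

(* Absolute convergence at h of the power series with coefficient matrices A(m) having columns of
   degree q': the m-th term has components "sum over |alpha| = m of h^alpha / alpha! * A(m)_{alpha,alpha'}",
   and all these summands are collected into one series over multiindices alpha. *)
definition abs_convergent_at ::
    "nat \<Rightarrow> (nat \<Rightarrow> 'n::finite mindex \<Rightarrow> 'k::finite mindex \<Rightarrow> 'a::real_normed_field) \<Rightarrow> 'a ^ 'n \<Rightarrow> bool" where
  "abs_convergent_at q' A h \<longleftrightarrow>
    (\<forall>\<alpha>'\<in>mindices q'.
      (\<lambda>\<alpha>. norm (mpower h \<alpha> / of_nat (mfact \<alpha>) * A (mdeg \<alpha>) \<alpha> \<alpha>')) summable_on UNIV)"

definition rho_exponent :: "ennreal \<Rightarrow> real" where
  "rho_exponent \<rho> = (if \<rho> = \<infinity> then 1 else (enn2real \<rho> - 1) / enn2real \<rho>)"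

lemma mdeg_munit: "mdeg (munit i) = 1"
  by (simp add: mdeg_def munit_def)

lemma munit_inj: "munit i = munit j \<longleftrightarrow> i = j"
  by (auto simp: munit_def fun_eq_iff split: if_splits)

lemma mindices_0: "mindices 0 = {\<lambda>_. 0}"
  by (auto simp: mindices_def mdeg_def)

lemma mindices_1: "mindices 1 = range munit"
proof
  show "mindices 1 \<subseteq> range (munit :: 'a \<Rightarrow> _)"
  proof
    fix \<alpha> :: "'a mindex" assume "\<alpha> \<in> mindices 1"
    hence s: "sum \<alpha> UNIV = 1" by (simp add: mindices_def mdeg_def)
    then obtain i where i: "\<alpha> i = 1" "\<And>j. j \<noteq> i \<Longrightarrow> \<alpha> j = 0"
      by (subst (asm) sum_eq_1_iff) auto
    hence "\<alpha> = munit i" by (auto simp: munit_def)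
    thus "\<alpha> \<in> range munit" by blast
  qed
qed (auto simp: mindices_def mdeg_munit)

lemma finite_mindices: "finite (mindices p :: 'n::finite mindex set)"
proof (rule finite_subset)
  show "(mindices p :: 'n mindex set) \<subseteq> PiE UNIV (\<lambda>_. {..p})"
    by (auto simp: mindices_def mdeg_def intro: member_le_sum)
qed (simp add: finite_PiE)

lemma mindices_nonempty: "(mindices p :: 'n::finite mindex set) \<noteq> {}"
proof -
  have "(\<lambda>j. if j = (undefined :: 'n) then p else 0) \<in> mindices p"
    by (simp add: mindices_def mdeg_def)
  thus ?thesis by blast
qed

lemma vec_matrix_munit: "vec_matrix h (\<lambda>_. 0) (munit i) = h $ i"
  by (simp add: vec_matrix_def munit_inj)

lemma vec_matrix_in: "vec_matrix h \<in> mmatrices 0 1"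
proof -
  have "\<alpha> \<in> mindices 0 \<and> \<alpha>' \<in> mindices 1" if "vec_matrix h \<alpha> \<alpha>' \<noteq> 0" for \<alpha> \<alpha>'
  proof -
    from that have "{i. \<alpha> = (\<lambda>_. 0) \<and> \<alpha>' = munit i} \<noteq> {}"
      unfolding vec_matrix_def by (metis sum.empty)
    thus ?thesis unfolding mindices_0 mindices_1 by blast
  qed
  thus ?thesis by (simp add: mmatrices_def)
qed

lemma vec_norm_finite:
  assumes "\<rho> \<noteq> \<infinity>"
  shows "vec_norm \<rho> h = (\<Sum>i\<in>UNIV. norm (h $ i) powr enn2real \<rho>) powr (1 / enn2real \<rho>)"
  unfolding vec_norm_def rho_norm_def mindices_0 mindices_1 using assms
  by (subst sum.reindex) (auto simp: inj_on_def munit_inj vec_matrix_munit mfact_def Let_def)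

lemma vec_norm_infinity: "vec_norm \<infinity> h = Max (range (\<lambda>i. norm (h $ i)))"
proof -
  have "(\<lambda>(\<alpha>, \<alpha>'). norm (vec_matrix h \<alpha> \<alpha>')) ` (mindices 0 \<times> mindices 1) = range (\<lambda>i. norm (h $ i))"
    unfolding mindices_0 mindices_1
    by (auto simp: vec_matrix_munit image_iff)
  thus ?thesis unfolding vec_norm_def rho_norm_def by (simp add: cSup_eq_Max)
qed

end

theory Submission imports Defs begin

text \<open>
  Both halves compare the degree \<open>m\<close> part of the series with \<open>\<parallel>A(m)\<parallel>\<^sub>\<rho>\<close>, up to a factor that does
  not depend on \<open>m\<close>; the root test for the numbers \<open>\<parallel>A(m)\<parallel>\<^sub>\<rho>\<close> then decides convergence.

  Convergence inside the radius comes from Hoelder's inequality with the weights \<open>1/\<alpha>!\<close>. By the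
  multinomial theorem the weighted \<open>\<sigma>\<close>-sum of the monomials is
  \<open>\<Sum>\<^sub>\<alpha> |h\<^sup>\<alpha>|\<^sup>\<sigma> / \<alpha>! = \<parallel>h\<parallel>\<^bsup>m\<sigma>\<^esup> / m!\<close>, and the powers of \<open>m!\<close> in the definition of the \<open>\<rho>\<close>-norm are
  exactly the ones that cancel this \<open>m!\<close>. What remains is
  \<open>\<Sum>\<^sub>\<alpha> |h\<^sup>\<alpha> A(m)\<^sub>\<alpha>\<^sub>\<alpha>\<^sub>'| / \<alpha>! \<le> q'! \<parallel>A(m)\<parallel>\<^sub>\<rho> \<parallel>h\<parallel>\<^sup>m\<close> (lemma \<open>component_le_norms\<close>), the term of a
  convergent series in one variable.

  Divergence happens on the diagonal: for \<open>h = (t, \<dots>, t)\<close> with \<open>t > 0\<close> every monomial of degree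
  \<open>m\<close> has the same value \<open>t\<^sup>m\<close>, so convergence bounds \<open>t\<^sup>m \<Sum> |A(m)\<^sub>\<alpha>\<^sub>\<alpha>\<^sub>'| / \<alpha>!\<close> uniformly in \<open>m\<close>, the
  sum being taken over \<open>\<alpha>\<close> and \<open>\<alpha>'\<close>. This sum is the norm for exponent 1, and it dominates the
  \<open>\<rho>\<close>-norm because \<open>\<alpha>! \<le> m!\<close> (lemma \<open>rho_norm_le_sum\<close>); hence \<open>t \<le> R\<close>. The norm of the diagonal vector is \<open>t n\<^bsup>1/\<sigma>\<^esup>\<close>, and \<open>1/\<sigma> = (\<rho> - 1)/\<rho>\<close> is the exponent
  of \<open>n\<close> in the theorem.
\<close>

section \<open>Conjugate exponents and Hoelder's inequality\<close>

lemma conjugate_exponents_cases: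
  fixes \<rho> \<sigma> :: ennreal
  assumes "1 \<le> \<rho>" "1 \<le> \<sigma>" "1 / \<rho> + 1 / \<sigma> = 1"
  obtains (one_inf) "\<rho> = 1" "\<sigma> = \<infinity>"
  | (inf_one) "\<rho> = \<infinity>" "\<sigma> = 1"
  | (reals) s t where "\<rho> = ennreal s" "\<sigma> = ennreal t" "1 < s" "1 < t" "1 / s + 1 / t = 1"
proof (cases "\<rho> = \<infinity>")
  case True
  hence "\<sigma> = 1" using assms by (metis add_0 ennreal_divide_top infinity_ennreal_def one_divide_one_divide_ennreal div_by_1 ennreal_divide_self ennreal_one_neq_top ennreal_one_less_top zero_neq_one)
  thus ?thesis using True inf_one by blast
next
  case rho: False
  show ?thesis
  proof (cases "\<sigma> = \<infinity>")
    case True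
    hence "\<rho> = 1" using assms by (metis add.right_neutral ennreal_divide_top infinity_ennreal_def one_divide_one_divide_ennreal ennreal_divide_self ennreal_one_less_top zero_neq_one)
    thus ?thesis using True one_inf by blast
  next
    case False
    define s t where "s = enn2real \<rho>" and "t = enn2real \<sigma>"
    have st: "\<rho> = ennreal s" "\<sigma> = ennreal t"
      using rho False by (simp_all add: s_def t_def less_top)
    have ge: "1 \<le> s" "1 \<le> t"
      using assms(1,2) st ennreal_le_1 by (metis ennreal_ge_1)+
    have "ennreal (1 / s + 1 / t) = 1"
      using assms(3) ge unfolding st
      by (simp add: divide_ennreal flip: ennreal_1 ennreal_plus)
    hence eq: "1 / s + 1 / t = 1" by simp
    have "0 < 1 / s" "0 < 1 / t" using ge by simp_all
    hence "1 / s < 1" "1 / t < 1" using eq by linarith+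
    hence "1 < s" "1 < t" using ge by (auto simp: field_simps)
    with st eq show ?thesis using reals by blast
  qed
qed

text \<open>Young's inequality, summed up after both factors are rescaled to weighted norm 1.\<close>
lemma weighted_Holder_inequality:
  fixes w f g :: "'i \<Rightarrow> real"
  assumes "1 < p" "1 < q" "1 / p + 1 / q = 1"
    and w: "\<And>i. i \<in> S \<Longrightarrow> 0 \<le> w i" and f: "\<And>i. i \<in> S \<Longrightarrow> 0 \<le> f i"
    and g: "\<And>i. i \<in> S \<Longrightarrow> 0 \<le> g i"
    and S: "finite S"
  shows "(\<Sum>i\<in>S. w i * (f i * g i))
    \<le> (\<Sum>i\<in>S. w i * f i powr p) powr (1 / p) * (\<Sum>i\<in>S. w i * g i powr q) powr (1 / q)"
proof -
  define P Q where "P = (\<Sum>i\<in>S. w i * f i powr p)" and "Q = (\<Sum>i\<in>S. w i * g i powr q)"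
  have nn: "0 \<le> P" "0 \<le> Q" unfolding P_def Q_def using w by (auto intro!: sum_nonneg)
  consider "P = 0 \<or> Q = 0" | "0 < P" "0 < Q" using nn by linarith
  thus ?thesis
  proof cases
    case 1
    hence "\<forall>i\<in>S. w i * (f i * g i) = 0"
      unfolding P_def Q_def using w S by (auto simp: sum_nonneg_eq_0_iff)
    hence "(\<Sum>i\<in>S. w i * (f i * g i)) = 0" by (intro sum.neutral)
    thus ?thesis by simp
  next
    case 2
    define a b where "a = P powr (1 / p)" and "b = Q powr (1 / q)"
    have ab: "0 < a" "0 < b" "a powr p = P" "b powr q = Q"
      using 2 assms(1,2) by (simp_all add: a_def b_def powr_powr)
    have "(\<Sum>i\<in>S. w i * (f i * g i)) = a * b * (\<Sum>i\<in>S. w i * (f i / a * (g i / b)))"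
      using ab(1,2) by (simp add: sum_distrib_left field_simps)
    also have "(\<Sum>i\<in>S. w i * (f i / a * (g i / b)))
        \<le> (\<Sum>i\<in>S. w i * ((f i / a) powr p / p + (g i / b) powr q / q))"
      using assms ab by (intro sum_mono mult_left_mono Youngs_inequality) auto
    also have "\<dots> = (\<Sum>i\<in>S. w i * f i powr p) / (P * p) + (\<Sum>i\<in>S. w i * g i powr q) / (Q * q)"
      using ab f g by (simp add: powr_divide distrib_left sum.distrib sum_divide_distrib)
    also have "\<dots> = 1"
      using 2 assms(1-3) unfolding P_def[symmetric] Q_def[symmetric] by simp
    finally show ?thesis using ab(1,2) unfolding a_def b_def P_def Q_def by simp
  qed
qed

section \<open>Multiindices\<close>

text \<open>The multinomial theorem, divided by \<open>m!\<close>. The induction rests on the identity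
  \<open>\<alpha>\<^sub>i x\<^sup>\<alpha> / \<alpha>! = x\<^sub>i x\<^sup>\<beta> / \<beta>!\<close>, where \<open>\<beta>\<close> is \<open>\<alpha>\<close> with its \<open>i\<close>-th entry lowered by one: summed
  over \<open>i\<close> and over the \<open>\<alpha>\<close> of degree \<open>m + 1\<close>, the left side gives \<open>m + 1\<close> times the sum in
  degree \<open>m + 1\<close>, the right side \<open>\<Sum>\<^sub>i x\<^sub>i\<close> times the sum in degree \<open>m\<close>.\<close>
lemma multinomial_sum:
  fixes x :: "'n::finite \<Rightarrow> 'a::field_char_0"
  shows "(\<Sum>\<alpha>\<in>mindices m. \<Prod>i\<in>UNIV. x i ^ \<alpha> i / fact (\<alpha> i)) = (\<Sum>i\<in>UNIV. x i) ^ m / fact m"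
proof (induction m)
  case 0
  show ?case by (simp add: mindices_0)
next
  case (Suc m)
  define g :: "'n mindex \<Rightarrow> 'a" where "g \<alpha> = (\<Prod>i\<in>UNIV. x i ^ \<alpha> i / fact (\<alpha> i))" for \<alpha>
  define up :: "'n \<Rightarrow> 'n mindex \<Rightarrow> 'n mindex" where "up i \<alpha> = \<alpha>(i := Suc (\<alpha> i))" for i \<alpha>
  have sum_up: "sum (up i \<alpha>) UNIV = Suc (sum \<alpha> UNIV)" for i \<alpha>
    by (simp add: up_def sum.remove[of UNIV i])
  have g_up: "of_nat (up i \<alpha> i) * g (up i \<alpha>) = x i * g \<alpha>" for i \<alpha>
  proof -
    have "(\<Prod>j\<in>UNIV - {i}. x j ^ up i \<alpha> j / fact (up i \<alpha> j))
        = (\<Prod>j\<in>UNIV - {i}. x j ^ \<alpha> j / fact (\<alpha> j))"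
      by (intro prod.cong) (auto simp: up_def)
    thus ?thesis
      unfolding g_def by (simp add: prod.remove[of UNIV i] up_def field_simps del: of_nat_Suc)
  qed
  have shift: "(\<Sum>\<alpha>\<in>mindices (Suc m). of_nat (\<alpha> i) * g \<alpha>) = (\<Sum>\<alpha>\<in>mindices m. x i * g \<alpha>)" for i
  proof -
    have "(\<Sum>\<alpha>\<in>mindices (Suc m). of_nat (\<alpha> i) * g \<alpha>)
        = (\<Sum>\<alpha> | \<alpha> \<in> mindices (Suc m) \<and> 0 < \<alpha> i. of_nat (\<alpha> i) * g \<alpha>)"
      by (intro sum.mono_neutral_right) (auto simp: finite_mindices)
    also have "\<dots> = (\<Sum>\<alpha>\<in>mindices m. x i * g \<alpha>)"
    proof (rule sum.reindex_bij_witness[of _ "up i" "\<lambda>\<alpha>. \<alpha>(i := \<alpha> i - 1)"])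
      fix \<alpha> :: "'n mindex" assume "\<alpha> \<in> {\<alpha>. \<alpha> \<in> mindices (Suc m) \<and> 0 < \<alpha> i}"
      hence a: "sum \<alpha> UNIV = Suc m" "0 < \<alpha> i" by (auto simp: mindices_def mdeg_def)
      show u: "up i (\<alpha>(i := \<alpha> i - 1)) = \<alpha>" using a by (auto simp: up_def)
      show "\<alpha>(i := \<alpha> i - 1) \<in> mindices m"
        using sum_up[of i "\<alpha>(i := \<alpha> i - 1)"] a unfolding u by (simp add: mindices_def mdeg_def)
      show "x i * g (\<alpha>(i := \<alpha> i - 1)) = of_nat (\<alpha> i) * g \<alpha>"
        using g_up[of i "\<alpha>(i := \<alpha> i - 1)"] unfolding u by simp
    next
      fix \<alpha> :: "'n mindex" assume "\<alpha> \<in> mindices m"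
      thus "up i \<alpha> \<in> {\<alpha>. \<alpha> \<in> mindices (Suc m) \<and> 0 < \<alpha> i}"
        by (simp add: mindices_def mdeg_def sum_up) (simp add: up_def)
      show "(up i \<alpha>)(i := up i \<alpha> i - 1) = \<alpha>" by (simp add: up_def)
    qed
    finally show ?thesis .
  qed
  have "of_nat (Suc m) * (\<Sum>\<alpha>\<in>mindices (Suc m). g \<alpha>)
      = (\<Sum>\<alpha>\<in>mindices (Suc m). (\<Sum>i\<in>UNIV. of_nat (\<alpha> i) * g \<alpha>))"
    unfolding sum_distrib_left
    by (intro sum.cong) (auto simp: mindices_def mdeg_def simp flip: sum_distrib_right of_nat_sum)
  also have "\<dots> = (\<Sum>i\<in>UNIV. \<Sum>\<alpha>\<in>mindices m. x i * g \<alpha>)"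
    by (subst sum.swap) (simp only: shift)
  also have "\<dots> = (\<Sum>i\<in>UNIV. x i) * (\<Sum>\<alpha>\<in>mindices m. g \<alpha>)"
    by (simp add: sum_product)
  also have "\<dots> = (\<Sum>i\<in>UNIV. x i) ^ Suc m / fact m"
    using Suc.IH by (simp add: g_def)
  finally show ?case
    by (simp add: g_def field_simps del: of_nat_Suc)
qed

lemma mfact_le_fact: "mfact \<alpha> \<le> fact (mdeg \<alpha>)"
proof -
  have "(\<Prod>i\<in>S. fact (\<alpha> i)) dvd (fact (\<Sum>i\<in>S. \<alpha> i) :: nat)" if "finite S" for S
    using that
  proof (induction S)
    case (insert i S)
    thus ?case by (auto intro: dvd_trans[OF mult_dvd_mono fact_fact_dvd_fact])
  qed simp
  thus ?thesis unfolding mfact_def mdeg_def by (intro dvd_imp_le) auto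
qed

section \<open>The root test with values in the extended half-line\<close>

lemma inverse_antimono_ennreal:
  fixes x y :: ennreal
  assumes "x \<le> y"
  shows "1 / y \<le> 1 / x"
proof (cases "x = 0 \<or> y = \<infinity>")
  case True
  thus ?thesis by auto
next
  case False
  with assms obtain a b where "x = ennreal a" "y = ennreal b" "0 \<le> a" "0 \<le> b"
    by (cases x; cases y) (auto simp: top_unique)
  with False assms show ?thesis
    by (auto simp: divide_ennreal frac_le simp flip: ennreal_1)
qed

text \<open>For \<open>N > 0\<close> the hypothesis leaves room for a \<open>c\<close> between the limes superior and \<open>1/N\<close>; then
  eventually \<open>a m \<le> c\<^sup>m\<close>, and the geometric series of ratio \<open>c N < 1\<close> dominates.\<close>
lemma summable_of_radius:
  fixes a :: "nat \<Rightarrow> real"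
  assumes a: "\<And>m. 0 \<le> a m" and N: "0 \<le> N"
    and lt: "ennreal N < 1 / limsup (\<lambda>m. ennreal (a m powr (1 / real m)))" (is "_ < 1 / ?r")
  shows "summable (\<lambda>m. a m * N ^ m)"
proof (cases "N = 0")
  case True
  show ?thesis by (rule summable_finite[of "{0}"]) (auto simp: True)
next
  case False
  with N have N: "0 < N" by simp
  have "?r < ennreal (1 / N)"
  proof (rule ccontr)
    assume "\<not> ?r < ennreal (1 / N)"
    hence "1 / ?r \<le> 1 / ennreal (1 / N)"
      by (intro inverse_antimono_ennreal) simp
    also have "\<dots> = ennreal N" using N by (simp add: divide_ennreal flip: ennreal_1)
    finally show False using lt by simp
  qed
  then obtain c' where c': "?r < c'" "c' < ennreal (1 / N)" using dense by blast
  define c where "c = enn2real c'"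
  have c: "c' = ennreal c" "0 \<le> c"
    using order.strict_trans[OF c'(2) ennreal_less_top] by (simp_all add: c_def)
  have "c < 1 / N" using c'(2) c N by (simp add: ennreal_less_iff)
  hence cN: "c * N < 1" using N by (simp add: field_simps)
  have "eventually (\<lambda>m. ennreal (a m powr (1 / real m)) < ennreal c) sequentially"
    using Limsup_lessD[OF c'(1)] c(1) by simp
  hence "eventually (\<lambda>m. norm (a m * N ^ m) \<le> (c * N) ^ m) sequentially"
    using eventually_gt_at_top[of 0]
  proof eventually_elim
    case (elim m)
    have "a m = (a m powr (1 / real m)) ^ m"
      using elim(2) a[of m] by (cases "a m = 0") (auto simp: powr_powr simp flip: powr_realpow)
    also have "\<dots> \<le> c ^ m"
      using elim(1) by (intro power_mono) (auto simp: ennreal_less_iff)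
    finally show ?case using a[of m] N by (simp add: power_mult_distrib mult_right_mono)
  qed
  thus ?thesis
    using cN c N by (intro summable_comparison_test_ev[OF _ summable_geometric]) auto
qed

text \<open>Boundedness of \<open>a m t\<^sup>m\<close> is enough, since the \<open>m\<close>-th root of the bound tends to 1.\<close>
lemma le_radius:
  fixes a :: "nat \<Rightarrow> real"
  assumes a: "\<And>m. 0 \<le> a m" and t: "0 < t" and bd: "\<And>m. a m * t ^ m \<le> K"
  shows "ennreal t \<le> 1 / limsup (\<lambda>m. ennreal (a m powr (1 / real m)))" (is "_ \<le> 1 / ?r")
proof -
  \<comment> \<open>The roots of the bound tend to 1 only if it is positive.\<close>
  define L where "L = max 1 K"
  have L: "0 < L" "\<And>m. a m * t ^ m \<le> L"
    using bd by (auto simp: L_def le_max_iff_disj)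
  have "eventually (\<lambda>m. ennreal (a m powr (1 / real m)) \<le> ennreal (L powr (1 / real m) / t)) sequentially"
    using eventually_gt_at_top[of 0]
  proof eventually_elim
    case (elim m)
    have "a m powr (1 / real m) \<le> (L / t ^ m) powr (1 / real m)"
      using a[of m] L(2)[of m] t by (intro powr_mono2) (auto simp: field_simps)
    also have "\<dots> = L powr (1 / real m) / t"
      using elim t L by (simp add: powr_divide powr_powr flip: powr_realpow)
    finally show ?case by (rule ennreal_leI)
  qed
  hence "?r \<le> limsup (\<lambda>m. ennreal (L powr (1 / real m) / t))" by (rule Limsup_mono)
  also have "\<dots> = ennreal (L powr 0 / t)"
    using L t by (intro lim_imp_Limsup tendsto_ennrealI tendsto_intros lim_1_over_n) auto
  also have "\<dots> = ennreal (1 / t)" using L by simp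
  finally have "1 / ennreal (1 / t) \<le> 1 / ?r" by (rule inverse_antimono_ennreal)
  moreover have "1 / ennreal (1 / t) = ennreal t" using t by (simp add: divide_ennreal flip: ennreal_1)
  ultimately show ?thesis by simp
qed


section \<open>Matrix norms and vector norms\<close>

lemma rho_norm_nonneg: "0 \<le> rho_norm \<rho> p p' A"
proof -
  have fin: "finite (mindices p \<times> mindices p')" by (simp add: finite_mindices)
  obtain \<alpha> :: "'a mindex" and \<alpha>' :: "'b mindex" where "\<alpha> \<in> mindices p" "\<alpha>' \<in> mindices p'"
    by (meson ex_in_conv mindices_nonempty)
  hence "0 \<le> (SUP (\<alpha>, \<alpha>') \<in> mindices p \<times> mindices p'. norm (A \<alpha> \<alpha>'))"
    using fin by (intro cSUP_upper2[where x = "(\<alpha>, \<alpha>')"] bdd_above_finite finite_imageI) auto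
  thus ?thesis by (auto simp: rho_norm_def Let_def)
qed

lemma rho_norm_ennreal:
  assumes "0 \<le> s"
  shows "rho_norm (ennreal s) p p' A =
    (\<Sum>\<alpha>\<in>mindices p. \<Sum>\<alpha>'\<in>mindices p'.
       norm (A \<alpha> \<alpha>') powr s / (real (mfact \<alpha>) * (fact p * fact p') powr (s - 1))) powr (1 / s)"
  using assms by (simp add: rho_norm_def)

lemma mfact_pos: "0 < mfact \<alpha>"
  unfolding mfact_def by (intro prod_pos) simp

lemma norm_le_rho_norm_infinity:
  assumes "\<alpha> \<in> mindices p" "\<alpha>' \<in> mindices p'"
  shows "norm (A \<alpha> \<alpha>') \<le> rho_norm \<infinity> p p' A * (fact p * fact p')"
proof -
  have "norm (A \<alpha> \<alpha>') \<le> (SUP (\<alpha>, \<alpha>') \<in> mindices p \<times> mindices p'. norm (A \<alpha> \<alpha>'))"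
    using assms by (intro cSUP_upper2[where x = "(\<alpha>, \<alpha>')"]) (auto simp: finite_mindices)
  thus ?thesis by (simp add: rho_norm_def)
qed

lemma vec_norm_nonneg: "0 \<le> vec_norm \<sigma> h"
  by (simp add: vec_norm_def rho_norm_nonneg)

lemma norm_mpower: "norm (mpower h \<alpha>) = (\<Prod>i\<in>UNIV. norm (h $ i) ^ \<alpha> i)"
  for h :: "'a::real_normed_field ^ 'n::finite"
  by (simp add: mpower_def norm_power prod_norm[symmetric])

lemma powr_of_power: "(x ^ m) powr t = (x powr t) ^ m" if "0 \<le> x" for x t :: real
  using that by (induction m) (simp_all add: powr_mult)

text \<open>The multinomial theorem at the point \<open>(|h\<^sub>1|\<^sup>t, \<dots>, |h\<^sub>n|\<^sup>t)\<close>.\<close>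
lemma sum_norm_mpower:
  fixes h :: "'a::real_normed_field ^ 'n::finite"
  shows "(\<Sum>\<alpha>\<in>mindices m. 1 / real (mfact \<alpha>) * norm (mpower h \<alpha>) powr t)
    = (\<Sum>i\<in>UNIV. norm (h $ i) powr t) ^ m / fact m"
proof -
  have "1 / real (mfact \<alpha>) * norm (mpower h \<alpha>) powr t
      = (\<Prod>i\<in>UNIV. (norm (h $ i) powr t) ^ \<alpha> i / fact (\<alpha> i))" for \<alpha>
  proof -
    have "norm (mpower h \<alpha>) powr t = (\<Prod>i\<in>UNIV. (norm (h $ i) ^ \<alpha> i) powr t)"
      unfolding norm_mpower by (rule prod_powr_distrib)
    also have "\<dots> = (\<Prod>i\<in>UNIV. (norm (h $ i) powr t) ^ \<alpha> i)"
      by (intro prod.cong refl) (simp add: powr_of_power)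
    finally show ?thesis by (simp add: mfact_def prod_dividef)
  qed
  thus ?thesis by (simp only: multinomial_sum)
qed

text \<open>Hoelder's inequality with weights \<open>1/\<alpha>!\<close>. One column of the matrix contributes at most
  \<open>(m! q'!)\<^bsup>1/\<sigma>\<^esup> \<parallel>A\<parallel>\<^sub>\<rho>\<close>, the monomials contribute \<open>\<parallel>h\<parallel>\<^sup>m / m!\<^bsup>1/\<sigma>\<^esup>\<close>. The remaining factor
  \<open>q'!\<^bsup>1/\<sigma>\<^esup>\<close> is rounded up to \<open>q'!\<close>, so that one bound serves all exponents. If one of the
  exponents is infinite, the maximum in its norm is pulled out of the sum instead.\<close>
lemma component_le_norms:
  fixes A :: "'n::finite mindex \<Rightarrow> 'k::finite mindex \<Rightarrow> 'a::real_normed_field"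
    and h :: "'a ^ 'n"
  assumes "1 \<le> \<rho>" "1 \<le> \<sigma>" "1 / \<rho> + 1 / \<sigma> = 1" and \<alpha>': "\<alpha>' \<in> mindices q'"
  shows "(\<Sum>\<alpha>\<in>mindices m. norm (mpower h \<alpha> / of_nat (mfact \<alpha>) * A \<alpha> \<alpha>'))
    \<le> fact q' * rho_norm \<rho> m q' A * vec_norm \<sigma> h ^ m"
proof -
  define w where "w \<alpha> = 1 / real (mfact \<alpha>)" for \<alpha> :: "'n mindex"
  define X where "X \<alpha> = norm (mpower h \<alpha>)" for \<alpha>
  have w: "0 \<le> w \<alpha>" and X: "0 \<le> X \<alpha>" for \<alpha> by (simp_all add: w_def X_def)
  have lhs: "norm (mpower h \<alpha> / of_nat (mfact \<alpha>) * A \<alpha> \<alpha>') = w \<alpha> * (norm (A \<alpha> \<alpha>') * X \<alpha>)" for \<alpha>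
    by (simp add: w_def X_def norm_mult norm_divide)
  have fact_q': "1 \<le> (fact q' :: real)" by simp
  have "(\<Sum>\<alpha>\<in>mindices m. w \<alpha> * (norm (A \<alpha> \<alpha>') * X \<alpha>))
      \<le> fact q' * rho_norm \<rho> m q' A * vec_norm \<sigma> h ^ m"
    using assms(1-3)
  proof (cases rule: conjugate_exponents_cases)
    case one_inf
    have rho: "rho_norm \<rho> m q' A
        = (\<Sum>\<alpha>\<in>mindices m. \<Sum>\<beta>\<in>mindices q'. w \<alpha> * norm (A \<alpha> \<beta>))"
      unfolding one_inf(1) using rho_norm_ennreal[of 1 m q' A] by (simp add: w_def sum_nonneg)
    have "X \<alpha> \<le> vec_norm \<sigma> h ^ m" if "\<alpha> \<in> mindices m" for \<alpha>
    proof -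
      have "norm (h $ i) \<le> vec_norm \<sigma> h" for i
        unfolding one_inf(2) vec_norm_infinity by (intro Max_ge) auto
      hence "X \<alpha> \<le> (\<Prod>i\<in>UNIV. vec_norm \<sigma> h ^ \<alpha> i)"
        unfolding X_def norm_mpower by (intro prod_mono) (auto intro: power_mono)
      also have "\<dots> = vec_norm \<sigma> h ^ m"
        using that by (simp add: mindices_def mdeg_def flip: power_sum)
      finally show ?thesis .
    qed
    hence "(\<Sum>\<alpha>\<in>mindices m. w \<alpha> * (norm (A \<alpha> \<alpha>') * X \<alpha>))
        \<le> (\<Sum>\<alpha>\<in>mindices m. w \<alpha> * (norm (A \<alpha> \<alpha>') * vec_norm \<sigma> h ^ m))"
      using w by (intro sum_mono mult_left_mono) auto
    also have "\<dots> = (\<Sum>\<alpha>\<in>mindices m. w \<alpha> * norm (A \<alpha> \<alpha>')) * vec_norm \<sigma> h ^ m"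
      by (simp add: sum_distrib_right mult.assoc)
    also have "(\<Sum>\<alpha>\<in>mindices m. w \<alpha> * norm (A \<alpha> \<alpha>')) \<le> rho_norm \<rho> m q' A"
      unfolding rho using w \<alpha>' finite_mindices
      by (intro sum_mono member_le_sum[where f = "\<lambda>\<beta>. w _ * norm (A _ \<beta>)"]) auto
    also have "\<dots> \<le> fact q' * rho_norm \<rho> m q' A"
      using mult_right_mono[OF fact_q' rho_norm_nonneg] by simp
    finally show ?thesis by (simp add: mult_right_mono vec_norm_nonneg)
  next
    case inf_one
    have N: "vec_norm \<sigma> h = (\<Sum>i\<in>UNIV. norm (h $ i))"
      unfolding inf_one by (subst vec_norm_finite) (auto simp: sum_nonneg)
    have "(\<Sum>\<alpha>\<in>mindices m. w \<alpha> * (norm (A \<alpha> \<alpha>') * X \<alpha>))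
        \<le> (\<Sum>\<alpha>\<in>mindices m. w \<alpha> * (rho_norm \<rho> m q' A * (fact m * fact q') * X \<alpha>))"
      unfolding inf_one using w X \<alpha>'
      by (intro sum_mono mult_left_mono mult_right_mono norm_le_rho_norm_infinity) auto
    also have "\<dots> = rho_norm \<rho> m q' A * (fact m * fact q') * (\<Sum>\<alpha>\<in>mindices m. w \<alpha> * X \<alpha>)"
      by (simp add: sum_distrib_left mult_ac)
    also have "(\<Sum>\<alpha>\<in>mindices m. w \<alpha> * X \<alpha>) = vec_norm \<sigma> h ^ m / fact m"
      using sum_norm_mpower[of h 1 m] by (simp add: N w_def X_def)
    finally show ?thesis by (simp add: mult_ac)
  next
    case (reals s t)
    define Z where "Z = (\<Sum>\<alpha>\<in>mindices m. \<Sum>\<beta>\<in>mindices q'.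
       norm (A \<alpha> \<beta>) powr s / (real (mfact \<alpha>) * (fact m * fact q') powr (s - 1)))"
    define H where "H = (\<Sum>i\<in>UNIV. norm (h $ i) powr t)"
    define D :: real where "D = fact m * fact q'"
    have nn: "0 \<le> Z" "0 \<le> H" "0 < D" by (auto simp: Z_def H_def D_def intro!: sum_nonneg)
    have rho: "rho_norm \<rho> m q' A = Z powr (1 / s)"
      using reals by (simp add: rho_norm_ennreal Z_def)
    have N: "vec_norm \<sigma> h = H powr (1 / t)"
      using reals by (simp add: vec_norm_finite H_def)
    have exponent: "(s - 1) / s = 1 / t" using reals by (simp add: field_simps)
    have "(\<Sum>\<alpha>\<in>mindices m. w \<alpha> * norm (A \<alpha> \<alpha>') powr s)
        \<le> (\<Sum>\<alpha>\<in>mindices m. \<Sum>\<beta>\<in>mindices q'. w \<alpha> * norm (A \<alpha> \<beta>) powr s)"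
      using w \<alpha>' finite_mindices
      by (intro sum_mono member_le_sum[where f = "\<lambda>\<beta>. w _ * norm (A _ \<beta>) powr s"]) auto
    also have "\<dots> = D powr (s - 1) * Z"
      unfolding Z_def w_def sum_distrib_left D_def by simp
    finally have A_part: "(\<Sum>\<alpha>\<in>mindices m. w \<alpha> * norm (A \<alpha> \<alpha>') powr s) powr (1 / s)
        \<le> (D powr (s - 1) * Z) powr (1 / s)"
      using reals w by (intro powr_mono2) (auto intro!: sum_nonneg)
    have "(\<Sum>\<alpha>\<in>mindices m. w \<alpha> * (norm (A \<alpha> \<alpha>') * X \<alpha>))
        \<le> (\<Sum>\<alpha>\<in>mindices m. w \<alpha> * norm (A \<alpha> \<alpha>') powr s) powr (1 / s)
          * (\<Sum>\<alpha>\<in>mindices m. w \<alpha> * X \<alpha> powr t) powr (1 / t)"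
      using reals w X finite_mindices by (intro weighted_Holder_inequality) auto
    also have "\<dots> \<le> (D powr (s - 1) * Z) powr (1 / s) * (H ^ m / fact m) powr (1 / t)"
      using A_part reals sum_norm_mpower[of h t m]
      by (intro mult_mono) (auto simp: H_def w_def X_def)
    also have "\<dots> = (fact q') powr (1 / t) * (Z powr (1 / s) * (H powr (1 / t)) ^ m)"
      using nn reals exponent
      by (simp add: powr_mult powr_divide powr_powr powr_of_power D_def mult.commute)
    also have "\<dots> \<le> fact q' * (Z powr (1 / s) * (H powr (1 / t)) ^ m)"
      using fact_q' reals powr_mono[of "1 / t" 1 "fact q' :: real"]
      by (intro mult_right_mono) auto
    finally show ?thesis by (simp add: rho N mult_ac)
  qed
  thus ?thesis by (simp only: lhs)
qed

text \<open>Let \<open>b = |A| / \<alpha>!\<close> denote the summands on the right, \<open>B\<close> their sum and \<open>D = m! q'!\<close>. From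
  \<open>\<alpha>! \<le> D\<close> every entry satisfies \<open>|A| \<le> B D\<close>, which is the claim for \<open>\<rho> = \<infinity>\<close>. For finite \<open>\<rho>\<close> the
  summand \<open>|A|\<^sup>\<rho> / (\<alpha>! D\<^bsup>\<rho>-1\<^esup>) = b (|A| / D)\<^bsup>\<rho>-1\<^esup>\<close> of the norm is at most \<open>b B\<^bsup>\<rho>-1\<^esup>\<close>, and these
  bounds add up to \<open>B\<^sup>\<rho>\<close>.\<close>
lemma rho_norm_le_sum:
  fixes A :: "'n::finite mindex \<Rightarrow> 'k::finite mindex \<Rightarrow> 'a::real_normed_field"
  assumes "1 \<le> \<rho>"
  shows "rho_norm \<rho> m q' A
    \<le> (\<Sum>\<alpha>\<in>mindices m. \<Sum>\<beta>\<in>mindices q'. norm (A \<alpha> \<beta>) / real (mfact \<alpha>))"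
proof -
  define b where "b \<alpha> \<beta> = norm (A \<alpha> \<beta>) / real (mfact \<alpha>)" for \<alpha> \<beta>
  define B where "B = (\<Sum>\<alpha>\<in>mindices m. \<Sum>\<beta>\<in>mindices q'. b \<alpha> \<beta>)"
  have b: "0 \<le> b \<alpha> \<beta>" for \<alpha> \<beta> by (simp add: b_def)
  have B: "0 \<le> B" unfolding B_def by (intro sum_nonneg b)
  have entry: "b \<alpha> \<beta> \<le> B" if "\<alpha> \<in> mindices m" "\<beta> \<in> mindices q'" for \<alpha> \<beta>
  proof -
    have "b \<alpha> \<beta> \<le> (\<Sum>\<beta>\<in>mindices q'. b \<alpha> \<beta>)"
      using that(2) b finite_mindices by (rule member_le_sum)
    also have "\<dots> \<le> B"
      unfolding B_def using that(1) sum_nonneg[OF b] finite_mindices by (rule member_le_sum)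
    finally show ?thesis .
  qed
  have A: "norm (A \<alpha> \<beta>) = b \<alpha> \<beta> * real (mfact \<alpha>)" for \<alpha> \<beta>
    using mfact_pos[of \<alpha>] by (simp add: b_def)
  define D :: real where "D = fact m * fact q'"
  have D: "real (mfact \<alpha>) \<le> D" if "\<alpha> \<in> mindices m" for \<alpha> :: "'n mindex"
  proof -
    have "mfact \<alpha> \<le> fact m" using mfact_le_fact[of \<alpha>] that by (simp add: mindices_def)
    also have "\<dots> \<le> fact m * fact q'" by simp
    finally have "real (mfact \<alpha>) \<le> real (fact m * fact q')" by (rule of_nat_mono)
    thus ?thesis by (simp add: D_def)
  qed
  have D_pos: "0 < D" by (simp add: D_def)
  have "rho_norm \<rho> m q' A \<le> B"
  proof (cases "\<rho> = \<infinity>")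
    case True
    have "(SUP (\<alpha>, \<beta>) \<in> mindices m \<times> mindices q'. norm (A \<alpha> \<beta>)) \<le> B * D"
    proof (rule cSUP_least)
      show "(mindices m :: 'n mindex set) \<times> (mindices q' :: 'k mindex set) \<noteq> {}"
        by (simp add: mindices_nonempty)
    next
      fix x :: "'n mindex \<times> 'k mindex" assume "x \<in> mindices m \<times> mindices q'"
      then obtain \<alpha> \<beta> where x: "x = (\<alpha>, \<beta>)" "\<alpha> \<in> mindices m" "\<beta> \<in> mindices q'" by blast
      have "norm (A \<alpha> \<beta>) \<le> B * D"
        unfolding A by (intro mult_mono entry D x B) simp
      thus "(case x of (\<alpha>, \<beta>) \<Rightarrow> norm (A \<alpha> \<beta>)) \<le> B * D" using x(1) by simp
    qed
    thus ?thesis using True D_pos by (simp add: rho_norm_def divide_le_eq flip: D_def)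
  next
    case False
    then obtain s where s: "\<rho> = ennreal s" "1 \<le> s"
      using assms by (cases \<rho>) (auto simp: ennreal_ge_1)
    have "norm (A \<alpha> \<beta>) powr s / (real (mfact \<alpha>) * D powr (s - 1)) \<le> b \<alpha> \<beta> * B powr (s - 1)"
      if "\<alpha> \<in> mindices m" "\<beta> \<in> mindices q'" for \<alpha> \<beta>
    proof -
      have "norm (A \<alpha> \<beta>) powr s = norm (A \<alpha> \<beta>) * norm (A \<alpha> \<beta>) powr (s - 1)"
        by (simp add: powr_mult_base)
      also have "\<dots> / (real (mfact \<alpha>) * D powr (s - 1))
          = b \<alpha> \<beta> * (norm (A \<alpha> \<beta>) / D) powr (s - 1)"
        using D_pos by (simp add: b_def powr_divide)
      also have "\<dots> \<le> b \<alpha> \<beta> * B powr (s - 1)"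
      proof (intro mult_left_mono powr_mono2 b)
        have "norm (A \<alpha> \<beta>) \<le> B * D"
          unfolding A by (intro mult_mono entry D that B) simp
        thus "norm (A \<alpha> \<beta>) / D \<le> B" using D_pos by (simp add: divide_le_eq)
      qed (use s D_pos in simp_all)
      finally show ?thesis .
    qed
    hence "(\<Sum>\<alpha>\<in>mindices m. \<Sum>\<beta>\<in>mindices q'.
        norm (A \<alpha> \<beta>) powr s / (real (mfact \<alpha>) * D powr (s - 1)))
        \<le> (\<Sum>\<alpha>\<in>mindices m. \<Sum>\<beta>\<in>mindices q'. b \<alpha> \<beta> * B powr (s - 1))"
      by (intro sum_mono)
    also have "\<dots> = B * B powr (s - 1)" by (simp add: B_def sum_distrib_right)
    also have "\<dots> = B powr s" using B by (simp add: powr_mult_base)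
    finally have "rho_norm \<rho> m q' A \<le> (B powr s) powr (1 / s)"
      using s D_pos unfolding s(1) D_def
      by (subst rho_norm_ennreal) (auto intro!: powr_mono2 sum_nonneg)
    also have "\<dots> = B" using s B by (simp add: powr_powr)
    finally show ?thesis .
  qed
  thus ?thesis by (simp add: B_def b_def)
qed

lemma vec_norm_const:
  fixes t :: real
  assumes "1 \<le> \<rho>" "1 \<le> \<sigma>" "1 / \<rho> + 1 / \<sigma> = 1" and t: "0 \<le> t"
  shows "vec_norm \<sigma> (\<chi> i. of_real t :: 'a::real_normed_field ^ 'n::finite)
    = t * real CARD('n) powr rho_exponent \<rho>"
  using assms(1-3)
proof (cases rule: conjugate_exponents_cases)
  case one_inf
  thus ?thesis using t vec_norm_infinity[of "(\<chi> i. of_real t) :: 'a ^ 'n"] by (simp add: rho_exponent_def)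
next
  case inf_one
  thus ?thesis using t by (simp add: vec_norm_finite rho_exponent_def)
next
  case (reals s u)
  have "(s - 1) / s = 1 / u" using reals by (simp add: field_simps)
  thus ?thesis using t reals
    by (simp add: vec_norm_finite rho_exponent_def powr_mult powr_powr)
qed

section \<open>Absolute convergence degree by degree\<close>

text \<open>Every finite set of multiindices lies in finitely many of the finite sets of multiindices of
  a given degree, so a summable bound on the degrees bounds all finite partial sums.\<close>
lemma abs_convergent_atI:
  fixes A :: "nat \<Rightarrow> 'n::finite mindex \<Rightarrow> 'k::finite mindex \<Rightarrow> 'a::real_normed_field"
  assumes "summable c" "\<And>m. 0 \<le> c m"
    and "\<And>m \<alpha>'. \<alpha>' \<in> mindices q' \<Longrightarrow>
      (\<Sum>\<alpha>\<in>mindices m. norm (mpower h \<alpha> / of_nat (mfact \<alpha>) * A m \<alpha> \<alpha>')) \<le> c m"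
  shows "abs_convergent_at q' A h"
  unfolding abs_convergent_at_def
proof
  fix \<alpha>' :: "'k mindex" assume \<alpha>': "\<alpha>' \<in> mindices q'"
  define f where "f \<alpha> = norm (mpower h \<alpha> / of_nat (mfact \<alpha>) * A (mdeg \<alpha>) \<alpha> \<alpha>')" for \<alpha>
  have f: "0 \<le> f \<alpha>" for \<alpha> by (simp add: f_def)
  have "sum f S \<le> suminf c" if S: "finite S" for S
  proof -
    have "sum f S = (\<Sum>m\<in>mdeg ` S. sum f {\<alpha> \<in> S. mdeg \<alpha> = m})"
      by (rule sum.image_gen[OF S])
    also have "\<dots> \<le> (\<Sum>m\<in>mdeg ` S. sum f (mindices m))"
      using f finite_mindices by (intro sum_mono sum_mono2) (auto simp: mindices_def)
    also have "\<dots> \<le> (\<Sum>m\<in>mdeg ` S. c m)"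
    proof (intro sum_mono)
      fix m
      have "sum f (mindices m)
          = (\<Sum>\<alpha>\<in>mindices m. norm (mpower h \<alpha> / of_nat (mfact \<alpha>) * A m \<alpha> \<alpha>'))"
        by (intro sum.cong) (auto simp: f_def mindices_def)
      thus "sum f (mindices m) \<le> c m" using assms(3)[OF \<alpha>'] by simp
    qed
    also have "\<dots> \<le> suminf c" using S assms(1,2) by (intro sum_le_suminf) auto
    finally show ?thesis .
  qed
  thus "f summable_on UNIV"
    using f by (intro nonneg_bounded_partial_sums_imp_summable_on eventually_finite_subsets_at_top_weakI)
qed

text \<open>On the diagonal all monomials of degree \<open>m\<close> equal \<open>t\<^sup>m\<close>, so the sum over one degree factors; it is
  a finite partial sum of the convergent series.\<close>
lemma abs_convergent_atD_const:
  fixes A :: "nat \<Rightarrow> 'n::finite mindex \<Rightarrow> 'k::finite mindex \<Rightarrow> 'a::real_normed_field"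
  assumes conv: "abs_convergent_at q' A (\<chi> i. of_real t)" and t: "0 \<le> t"
  obtains K where "\<And>m. (\<Sum>\<alpha>\<in>mindices m. \<Sum>\<beta>\<in>mindices q'. norm (A m \<alpha> \<beta>) / real (mfact \<alpha>)) * t ^ m \<le> K"
proof (rule that)
  define f where "f \<beta> \<alpha> =
    norm (mpower (\<chi> i. of_real t) \<alpha> / of_nat (mfact \<alpha>) * A (mdeg \<alpha>) \<alpha> \<beta>)" for \<alpha> \<beta>
  have summable: "f \<beta> summable_on UNIV" if "\<beta> \<in> mindices q'" for \<beta>
    using conv that unfolding abs_convergent_at_def f_def by blast
  fix m
  have f: "f \<beta> \<alpha> = norm (A m \<alpha> \<beta>) / real (mfact \<alpha>) * t ^ m" if "\<alpha> \<in> mindices m" for \<alpha> \<beta>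
    using that t
    by (auto simp: f_def mindices_def mdeg_def norm_mult norm_divide norm_mpower simp flip: power_sum)
  have "(\<Sum>\<alpha>\<in>mindices m. \<Sum>\<beta>\<in>mindices q'. norm (A m \<alpha> \<beta>) / real (mfact \<alpha>)) * t ^ m
      = (\<Sum>\<alpha>\<in>mindices m. \<Sum>\<beta>\<in>mindices q'. f \<beta> \<alpha>)"
    by (simp add: f sum_distrib_right)
  also have "\<dots> = (\<Sum>\<beta>\<in>mindices q'. sum (f \<beta>) (mindices m))" by (rule sum.swap)
  also have "\<dots> \<le> (\<Sum>\<beta>\<in>mindices q'. infsum (f \<beta>) UNIV)"
    using finite_mindices
    by (intro sum_mono finite_sum_le_infsum summable) (auto simp: f_def)
  finally show "(\<Sum>\<alpha>\<in>mindices m. \<Sum>\<beta>\<in>mindices q'. norm (A m \<alpha> \<beta>) / real (mfact \<alpha>)) * t ^ m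
    \<le> (\<Sum>\<beta>\<in>mindices q'. infsum (f \<beta>) UNIV)" .
qed

section \<open>The radius of convergence\<close>

lemma abs_convergent_inside_radius:
  fixes A :: "nat \<Rightarrow> 'n::finite mindex \<Rightarrow> 'k::finite mindex \<Rightarrow> 'a::real_normed_field"
    and h :: "'a ^ 'n"
  assumes conj: "1 \<le> \<rho>" "1 \<le> \<sigma>" "1 / \<rho> + 1 / \<sigma> = 1"
    and h: "ennreal (vec_norm \<sigma> h)
      < 1 / limsup (\<lambda>m. ennreal (rho_norm \<rho> m q' (A m) powr (1 / real m)))"
  shows "abs_convergent_at q' A h"
proof (rule abs_convergent_atI)
  let ?c = "\<lambda>m. fact q' * (rho_norm \<rho> m q' (A m) * vec_norm \<sigma> h ^ m)"
  show "summable ?c"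
    by (intro summable_mult summable_of_radius rho_norm_nonneg vec_norm_nonneg h)
  show "0 \<le> ?c m" for m
    by (simp add: rho_norm_nonneg vec_norm_nonneg)
  show "(\<Sum>\<alpha>\<in>mindices m. norm (mpower h \<alpha> / of_nat (mfact \<alpha>) * A m \<alpha> \<alpha>')) \<le> ?c m"
    if "\<alpha>' \<in> mindices q'" for m \<alpha>'
    using component_le_norms[OF conj that, where m = m and h = h and A = "A m"]
    by (simp add: mult.assoc)
qed

text \<open>Convergence at a diagonal point bounds the norms for exponent 1, which dominate the \<open>\<rho>\<close>-norms.
  Read backwards, this gives divergence at every diagonal point with entries beyond the radius.\<close>
lemma diagonal_le_radius:
  fixes A :: "nat \<Rightarrow> 'n::finite mindex \<Rightarrow> 'k::finite mindex \<Rightarrow> 'a::real_normed_field"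
  assumes "1 \<le> \<rho>" and t: "0 < t"
    and conv: "abs_convergent_at q' A (\<chi> i. of_real t)"
  shows "ennreal t \<le> 1 / limsup (\<lambda>m. ennreal (rho_norm \<rho> m q' (A m) powr (1 / real m)))"
proof -
  from conv less_imp_le[OF t] obtain K where K: "\<And>m. (\<Sum>\<alpha>\<in>mindices m. \<Sum>\<beta>\<in>mindices q'.
      norm (A m \<alpha> \<beta>) / real (mfact \<alpha>)) * t ^ m \<le> K"
    by (rule abs_convergent_atD_const) blast
  have "rho_norm \<rho> m q' (A m) * t ^ m \<le> K" for m
    using t by (intro order_trans[OF mult_right_mono[OF rho_norm_le_sum[OF assms(1)]] K]) simp
  thus ?thesis by (rule le_radius[OF rho_norm_nonneg t])
qed

theorem theorem2:
  fixes A :: "nat \<Rightarrow> 'n::finite mindex \<Rightarrow> 'k::finite mindex \<Rightarrow> 'a::real_normed_field"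
    and q' :: nat
    and \<rho> \<sigma> :: ennreal
    and r R :: ennreal
  assumes "1 \<le> \<rho>" and "1 \<le> \<sigma>" and "1 / \<rho> + 1 / \<sigma> = 1"
    and "\<And>m. A m \<in> mmatrices m q'"
    and "r = limsup (\<lambda>m. ennreal (rho_norm \<rho> m q' (A m) powr (1 / real m)))"
    and "R = 1 / r"
  shows "(\<forall>h :: 'a ^ 'n. ennreal (vec_norm \<sigma> h) < R \<longrightarrow> abs_convergent_at q' A h) \<and>
    (\<forall>R\<^sub>1 :: real. R * ennreal (real CARD('n) powr rho_exponent \<rho>) < ennreal R\<^sub>1 \<longrightarrow>
      (\<exists>h :: 'a ^ 'n. vec_norm \<sigma> h = R\<^sub>1 \<and> \<not> abs_convergent_at q' A h))"
proof (intro conjI allI impI)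
  fix h :: "'a ^ 'n" assume "ennreal (vec_norm \<sigma> h) < R"
  thus "abs_convergent_at q' A h"
    unfolding assms(5,6) by (rule abs_convergent_inside_radius[OF assms(1-3)])
next
  fix R\<^sub>1 :: real
  define N where "N = real CARD('n) powr rho_exponent \<rho>"
  have N: "0 < N" by (simp add: N_def)
  \<comment> \<open>This makes the diagonal vector with entries \<open>t\<close> have norm \<open>R\<^sub>1\<close>.\<close>
  define t where "t = R\<^sub>1 / N"
  assume less: "R * ennreal (real CARD('n) powr rho_exponent \<rho>) < ennreal R\<^sub>1"
  hence "0 < ennreal R\<^sub>1" by (rule le_less_trans[OF zero_le])
  hence t: "0 < t" "R\<^sub>1 = t * N" using N by (simp_all add: t_def)
  have "\<not> abs_convergent_at q' A (\<chi> i. of_real t)"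
  proof
    assume "abs_convergent_at q' A (\<chi> i. of_real t)"
    hence "ennreal t \<le> R"
      unfolding assms(5,6) by (rule diagonal_le_radius[OF assms(1) t(1)])
    hence "ennreal R\<^sub>1 \<le> R * ennreal N"
      using t N by (simp add: ennreal_mult mult_right_mono)
    thus False using less by (simp add: N_def)
  qed
  moreover have "vec_norm \<sigma> (\<chi> i. of_real t :: 'a ^ 'n) = R\<^sub>1"
    using vec_norm_const[OF assms(1-3), of t] t by (simp add: N_def)
  ultimately show "\<exists>h :: 'a ^ 'n. vec_norm \<sigma> h = R\<^sub>1 \<and> \<not> abs_convergent_at q' A h" by blast
qed

end
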